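(* Let $T>0$ and let $f\colon[0,T]\times\mathbb{R}^m\to\mathbb{R}^m$ be a continuous function. Let $A\colon\mathbb{R}^m\setminus\{0\}\to\,]0,+\infty[$ be a continuous function and let $$\phi(\xi):=A(\xi)\xi\ \text{ if }\xi\in\mathbb{R}^m\setminus\{0\},\qquad \phi(0)=0.$$ Suppose that $\phi\colon\mathbb{R}^m\to\mathbb{R}^m$ is a homeomorphism (onto $\mathbb{R}^m$). If there exists $R>0$ such that $$\langle f(t,\xi),\xi\rangle\leq0,\quad\forall\,t\in[0,T],\ \forall\,\xi\in\mathbb{R}^m\text{ with }\|\xi\|_{\mathbb{R}^m}=R,$$ then there exists at least a $T$-periodic solution $u(t)$ of $$(\phi(u'))'+f(t,u)=0$$ such that $\|u(t)\|_{\mathbb{R}^m}\leq R$ for all $t\in[0,T]$.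
   Context: $\langle\cdot,\cdot\rangle$ and $\|\cdot\|_{\mathbb{R}^m}$ are the standard inner product and Euclidean norm on $\mathbb{R}^m$. A $T$-periodic solution is a continuously differentiable $u\colon[0,T]\to\mathbb{R}^m$ with $u(0)=u(T)$, $u'(0)=u'(T)$, such that $t\mapsto\phi(u'(t))$ is absolutely continuous and the equation holds on $[0,T]$ (a.e.; hence everywhere since $f$ is continuous). *)

theory Defs
  imports "HOL-Analysis.Analysis"
begin

definition phi_of :: "(real ^ 'n \<Rightarrow> real) \<Rightarrow> real ^ 'n \<Rightarrow> real ^ 'n" where
  "phi_of A \<xi> = (if \<xi> = 0 then 0 else A \<xi> *\<^sub>R \<xi>)"

(* Absolute continuity of functions of a real variable in the usual epsilon-delta form; the
   constant absolutely_continuous of HOL-Analysis concerns measures. The intervals are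
   nonoverlapping: they may share endpoints. *)
definition abs_continuous_on :: "real set \<Rightarrow> (real \<Rightarrow> 'a::real_normed_vector) \<Rightarrow> bool" where
  "abs_continuous_on I g \<longleftrightarrow>
     (\<forall>\<epsilon>>0. \<exists>\<delta>>0. \<forall>(n::nat) (a::nat \<Rightarrow> real) (b::nat \<Rightarrow> real).
        (\<forall>i<n. a i < b i \<and> {a i..b i} \<subseteq> I) \<and>
        disjoint_family_on (\<lambda>i. {a i<..<b i}) {..<n} \<and>
        (\<Sum>i<n. b i - a i) < \<delta>
        \<longrightarrow> (\<Sum>i<n. norm (g (b i) - g (a i))) < \<epsilon>)"

(* T-periodic solutions of (phi(u'))' + f(t,u) = 0. Derivatives at the endpoints 0 and T
   are one-sided; values of u outside [0,T] play no role. *)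
definition periodic_solution ::
  "real \<Rightarrow> (real ^ 'n \<Rightarrow> real ^ 'n) \<Rightarrow> (real \<Rightarrow> real ^ 'n \<Rightarrow> real ^ 'n) \<Rightarrow> (real \<Rightarrow> real ^ 'n) \<Rightarrow> bool"
where
  "periodic_solution T \<phi> f u \<longleftrightarrow>
     (\<exists>u'. (\<forall>t\<in>{0..T}. (u has_vector_derivative u' t) (at t within {0..T})) \<and>
           continuous_on {0..T} u' \<and>
           u 0 = u T \<and> u' 0 = u' T \<and>
           abs_continuous_on {0..T} (\<lambda>t. \<phi> (u' t)) \<and>
           (AE t in lebesgue_on {0..T}.
              \<exists>d. ((\<lambda>s. \<phi> (u' s)) has_vector_derivative d) (at t within {0..T}) \<and>
                  d + f t (u t) = 0))"

end

theory Submission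
  imports Defs "HOL-Complex_Analysis.Great_Picard"
begin

text \<open>
  Discretise the problem on \<open>N\<close> cyclically arranged grid points with mesh \<open>h = T / N\<close>. The map
  sending \<open>u\<close> to \<open>\<phi> ((u\<^bsub>k+1\<^esub> - u\<^sub>k) / h) - \<phi> ((u\<^sub>k - u\<^bsub>k-1\<^esub>) / h) + h f (t\<^sub>k, u\<^sub>k)\<close> points into the product of
  the balls of radius \<open>R\<close>, because \<open>\<phi> \<xi>\<close> is a positive multiple of \<open>\<xi>\<close> and \<open>f\<close> does not point out of
  the sphere; hence it has a zero there by Brouwer's theorem. The discrete fluxes \<open>w\<^sub>k = \<phi> ((u\<^bsub>k+1\<^esub> - u\<^sub>k) / h)\<close> differ from each other by at most
  \<open>T sup \<bar>f\<bar>\<close>. If one of them were longer than that, all of them, and therefore all increments of \<open>u\<close>,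
  would lie in a common open half space, although the increments sum to zero over a period. So the
  \<open>w\<^sub>k\<close>, and by continuity of \<open>\<phi>\<^sup>-\<^sup>1\<close> the difference quotients of \<open>u\<close>, are bounded independently of \<open>N\<close>.
  By the Arzela-Ascoli theorem the piecewise linear interpolants of \<open>u\<close> and \<open>w\<close> converge along a
  subsequence, and the limits satisfy \<open>u' = \<phi>\<^sup>-\<^sup>1 w\<close> and \<open>w' = - f (t, u)\<close>.
\<close>

section \<open>Brouwer's fixed point theorem on cubes of arbitrary finite dimension\<close>

lemma compact_Pi_UNIV:
  fixes S :: "'i \<Rightarrow> 'a::topological_space set"
  assumes "\<And>i. compact (S i)"
  shows "compact (Pi UNIV S)"
proof -
  have "compactin (product_topology (\<lambda>i. euclidean) UNIV) (PiE UNIV S)"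
    using assms by (simp add: compactin_PiE)
  then show ?thesis
    by (simp add: euclidean_product_topology PiE_UNIV_domain)
qed

text \<open>
  The Brouwer theorem of the library is about Euclidean space types and so cannot be applied to a
  number of grid points that varies within a proof; Kuhn's combinatorial lemma has no such restriction.
\<close>

lemma cube_approximate_fixpoint:
  fixes F :: "('i \<Rightarrow> real) \<Rightarrow> 'i \<Rightarrow> real" and a b :: real and I :: "'i set" and p :: nat
  defines "C \<equiv> Pi UNIV (\<lambda>i. if i \<in> I then {a..b} else {0})"
  assumes "finite I" "a \<le> b" "p > 0"
    and F: "\<And>x i. x \<in> C \<Longrightarrow> i \<in> I \<Longrightarrow> F x i \<in> {a..b}"
  shows "\<exists>z\<in>C. \<forall>i\<in>I. \<exists>r\<in>C. \<exists>s\<in>C.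
    (\<forall>j. \<bar>r j - z j\<bar> \<le> (b - a) / p) \<and> (\<forall>j. \<bar>s j - z j\<bar> \<le> (b - a) / p) \<and> r i \<le> F r i \<and> F s i \<le> s i"
proof -
  define n where "n = card I"
  obtain e where e: "bij_betw e {..<n} I"
    using ex_bij_betw_nat_finite[OF \<open>finite I\<close>] by (auto simp: n_def lessThan_atLeast0)
  define e' where "e' = inv_into {..<n} e"
  have e': "e' i < n" "e (e' i) = i" if "i \<in> I" for i
    using that e inv_into_into[of i e "{..<n}"] by (auto simp: e'_def bij_betw_def f_inv_into_f)
  have e_in: "e k \<in> I" "e' (e k) = k" if "k < n" for k
    using that e by (auto simp: e'_def bij_betw_def)
  \<comment> \<open>The integer grid of Kuhn's lemma is mapped affinely onto a grid of mesh
    \<open>(b - a) / p\<close> in the cube.\<close>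
  define y :: "(nat \<Rightarrow> nat) \<Rightarrow> 'i \<Rightarrow> real" where
    "y x i = (if i \<in> I then a + (b - a) * (x (e' i) / p) else 0)" for x i
  have yC: "y x \<in> C" if "\<forall>k<n. x k \<le> p" for x
  proof -
    have "a + (b - a) * (x k / p) \<in> {a..b}" if "k < n" for k
    proof -
      have "(b - a) * (x k / p) \<le> (b - a) * 1"
        using \<open>a \<le> b\<close> \<open>p > 0\<close> \<open>\<forall>k<n. x k \<le> p\<close> that by (intro mult_left_mono) auto
      then show ?thesis using \<open>a \<le> b\<close> by auto
    qed
    then show ?thesis using e' by (auto simp: C_def y_def)
  qed
  \<comment> \<open>Label 0 records that \<open>F\<close> does not lower the coordinate. The clause
    \<open>x k \<noteq> p\<close> forces label 1 on the upper face, as Kuhn's lemma demands; the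
    coordinate there is \<open>b\<close>, which \<open>F\<close> cannot exceed, so
    \<open>lab1\<close> remains true.\<close>
  define label where "label x k = (if y x (e k) \<le> F (y x) (e k) \<and> x k \<noteq> p then 0 else 1::nat)" for x k
  have lab0: "y x (e k) \<le> F (y x) (e k)" if "label x k = 0" for x k
    using that by (auto simp: label_def split: if_splits)
  have lab1: "F (y x) (e k) \<le> y x (e k)" if "label x k \<noteq> 0" "\<forall>k<n. x k \<le> p" "k < n" for x k
    using that F[OF yC[OF that(2)], of "e k"] \<open>p > 0\<close> e_in[OF that(3)]
    by (auto simp: label_def y_def split: if_splits)
  obtain q where q: "\<forall>k<n. q k < p"
    and rs: "\<forall>i<n. \<exists>r s. (\<forall>j<n. q j \<le> r j \<and> r j \<le> q j + 1) \<and> (\<forall>j<n. q j \<le> s j \<and> s j \<le> q j + 1) \<and> label r i \<noteq> label s i"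
  proof (rule kuhn_lemma[OF \<open>p > 0\<close>, of n label])
    show "\<forall>x. (\<forall>i<n. x i \<le> p) \<longrightarrow> (\<forall>i<n. x i = 0 \<longrightarrow> label x i = 0)"
    proof (intro allI impI)
      fix x k assume x: "\<forall>i<n. x i \<le> p" and "k < n" and "x k = (0::nat)"
      then show "label x k = 0"
        using F[OF yC[OF x], of "e k"] \<open>p > 0\<close> e_in[OF \<open>k < n\<close>] by (auto simp: label_def y_def)
    qed
  qed (auto simp: label_def)
  have "y q \<in> C" using q by (intro yC) auto
  moreover have "\<exists>r\<in>C. \<exists>s\<in>C. (\<forall>j. \<bar>r j - y q j\<bar> \<le> (b - a) / p) \<and>
      (\<forall>j. \<bar>s j - y q j\<bar> \<le> (b - a) / p) \<and> r i \<le> F r i \<and> F s i \<le> s i" if "i \<in> I" for i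
  proof -
    have near: "\<bar>y r j - y q j\<bar> \<le> (b - a) / p" if r: "\<forall>j<n. q j \<le> r j \<and> r j \<le> q j + 1" for r j
    proof (cases "j \<in> I")
      case True
      have "real (r (e' j)) - real (q (e' j)) \<le> 1" "real (r (e' j)) - real (q (e' j)) \<ge> 0"
        using r e'(1)[OF True] by force+
      then have "\<bar>(b - a) * ((real (r (e' j)) - real (q (e' j))) / p)\<bar> \<le> (b - a) * (1 / p)"
        unfolding abs_mult using \<open>a \<le> b\<close> \<open>p > 0\<close>
        by (intro mult_mono) (auto simp: divide_right_mono)
      then show ?thesis using True by (simp add: y_def algebra_simps diff_divide_distrib)
    qed (use \<open>a \<le> b\<close> in \<open>simp add: y_def\<close>)
    have leC: "y r \<in> C" "\<forall>k<n. r k \<le> p" if r: "\<forall>j<n. q j \<le> r j \<and> r j \<le> q j + 1" for r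
    proof -
      show "\<forall>k<n. r k \<le> p" using q r by (metis Suc_eq_plus1 Suc_leI le_trans)
      then show "y r \<in> C" by (rule yC)
    qed
    have "e' i < n" "e (e' i) = i" using e' \<open>i \<in> I\<close> by auto
    then obtain r s where r: "\<forall>j<n. q j \<le> r j \<and> r j \<le> q j + 1"
      and s: "\<forall>j<n. q j \<le> s j \<and> s j \<le> q j + 1" and "label r (e' i) \<noteq> label s (e' i)"
      using rs by blast
    \<comment> \<open>Kuhn's lemma leaves open which of the two vertices carries label 0; that one
      takes the role of \<open>r\<close> in the claim.\<close>
    then consider "label r (e' i) = 0" "label s (e' i) \<noteq> 0" | "label s (e' i) = 0" "label r (e' i) \<noteq> 0"
      by (auto simp: label_def split: if_splits)
    then show ?thesis
    proof cases
      case 1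
      with lab0[of r "e' i"] lab1[of s "e' i"] leC[OF r] leC[OF s] near[OF r] near[OF s] \<open>e' i < n\<close> \<open>e (e' i) = i\<close>
      show ?thesis by (intro bexI[of _ "y r"] bexI[of _ "y s"]) auto
    next
      case 2
      with lab0[of s "e' i"] lab1[of r "e' i"] leC[OF r] leC[OF s] near[OF r] near[OF s] \<open>e' i < n\<close> \<open>e (e' i) = i\<close>
      show ?thesis by (intro bexI[of _ "y s"] bexI[of _ "y r"]) auto
    qed
  qed
  ultimately show ?thesis by blast
qed

lemma tendsto_fun_iff:
  fixes f :: "'a \<Rightarrow> 'i \<Rightarrow> 'b::topological_space"
  shows "(f \<longlongrightarrow> l) G \<longleftrightarrow> (\<forall>i. ((\<lambda>x. f x i) \<longlongrightarrow> l i) G)"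
  using limitin_componentwise[of "\<lambda>i. euclidean" UNIV f l G]
  by (simp add: euclidean_product_topology)

text \<open>As the mesh shrinks, a subsequence of the approximate points converges to some
  \<open>x\<close>. The vertices \<open>r\<close> and \<open>s\<close> belonging to a fixed
  coordinate converge to the same \<open>x\<close>, so continuity gives both inequalities at
  \<open>x\<close>. Countability of the index type makes the function space first countable, whence
  compactness yields sequences.\<close>

lemma brouwer_finite_cube:
  fixes F :: "('i::countable \<Rightarrow> real) \<Rightarrow> 'i \<Rightarrow> real" and a b :: real and I :: "'i set"
  defines "C \<equiv> Pi UNIV (\<lambda>i. if i \<in> I then {a..b} else {0})"
  assumes "finite I" "a \<le> b"
    and F: "\<And>x i. x \<in> C \<Longrightarrow> i \<in> I \<Longrightarrow> F x i \<in> {a..b}"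
    and cont: "\<And>i. i \<in> I \<Longrightarrow> continuous_on C (\<lambda>x. F x i)"
  shows "\<exists>x\<in>C. \<forall>i\<in>I. F x i = x i"
proof -
  have "\<forall>m. \<exists>z\<in>C. \<forall>i\<in>I. \<exists>r\<in>C. \<exists>s\<in>C.
    (\<forall>j. \<bar>r j - z j\<bar> \<le> (b - a) / Suc m) \<and> (\<forall>j. \<bar>s j - z j\<bar> \<le> (b - a) / Suc m) \<and> r i \<le> F r i \<and> F s i \<le> s i"
    using cube_approximate_fixpoint[OF \<open>finite I\<close> \<open>a \<le> b\<close>, where F = F] F unfolding C_def by blast
  then obtain z where z: "\<And>m. z m \<in> C" and near: "\<forall>m. \<forall>i\<in>I. \<exists>r\<in>C. \<exists>s\<in>C.
    (\<forall>j. \<bar>r j - z m j\<bar> \<le> (b - a) / Suc m) \<and> (\<forall>j. \<bar>s j - z m j\<bar> \<le> (b - a) / Suc m) \<and> r i \<le> F r i \<and> F s i \<le> s i"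
    by metis
  have "compact C" unfolding C_def by (intro compact_Pi_UNIV) auto
  then obtain x k where "x \<in> C" and k: "strict_mono k" "(z \<circ> k) \<longlonglongrightarrow> x"
    using z compact_imp_seq_compact unfolding seq_compact_def by meson
  have null: "(\<lambda>m. (b - a) / Suc (k m)) \<longlonglongrightarrow> 0"
    using LIMSEQ_subseq_LIMSEQ[OF tendsto_mult_right_zero[OF LIMSEQ_inverse_real_of_nat, of "b - a"] k(1)]
    by (simp add: o_def divide_inverse)
  have lim: "(\<lambda>m. t (k m)) \<longlonglongrightarrow> x" if "\<And>m j. \<bar>t m j - z m j\<bar> \<le> (b - a) / Suc m" for t
  proof -
    have "(\<lambda>m. t (k m) j) \<longlonglongrightarrow> x j" for j
    proof -
      have "(\<lambda>m. t (k m) j - z (k m) j) \<longlonglongrightarrow> 0"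
        by (rule tendsto_rabs_zero_cancel, rule tendsto_sandwich[OF _ _ tendsto_const null])
          (use that in auto)
      moreover have "(\<lambda>m. z (k m) j) \<longlonglongrightarrow> x j"
        using k(2) by (simp add: tendsto_fun_iff o_def)
      ultimately show ?thesis using tendsto_add by fastforce
    qed
    then show ?thesis by (simp add: tendsto_fun_iff)
  qed
  have "F x i = x i" if "i \<in> I" for i
  proof -
    have "\<forall>m. \<exists>r s. r \<in> C \<and> s \<in> C \<and> (\<forall>j. \<bar>r j - z m j\<bar> \<le> (b - a) / Suc m) \<and>
      (\<forall>j. \<bar>s j - z m j\<bar> \<le> (b - a) / Suc m) \<and> r i \<le> F r i \<and> F s i \<le> s i"
      using near that by blast
    then obtain r s where rs: "\<And>m. r m \<in> C" "\<And>m. s m \<in> C"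
      "\<And>m j. \<bar>r m j - z m j\<bar> \<le> (b - a) / Suc m" "\<And>m j. \<bar>s m j - z m j\<bar> \<le> (b - a) / Suc m"
      "\<And>m. r m i \<le> F (r m) i" "\<And>m. F (s m) i \<le> s m i"
      unfolding choice_iff by blast
    note cont' = continuous_on_tendsto_compose[OF cont[OF that] _ \<open>x \<in> C\<close> always_eventually]
    have "(\<lambda>m. r (k m)) \<longlonglongrightarrow> x" "(\<lambda>m. s (k m)) \<longlonglongrightarrow> x"
      using lim[of r] lim[of s] rs(3,4) by auto
    then have "(\<lambda>m. F (r (k m)) i) \<longlonglongrightarrow> F x i" "(\<lambda>m. F (s (k m)) i) \<longlonglongrightarrow> F x i"
      "(\<lambda>m. r (k m) i) \<longlonglongrightarrow> x i" "(\<lambda>m. s (k m) i) \<longlonglongrightarrow> x i"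
      using cont'[of "\<lambda>m. r (k m)"] cont'[of "\<lambda>m. s (k m)"] rs(1,2)
      by (auto simp: tendsto_fun_iff)
    then have "x i \<le> F x i" "F x i \<le> x i"
      using rs(5,6) by (meson LIMSEQ_le)+
    then show ?thesis by simp
  qed
  with \<open>x \<in> C\<close> show ?thesis by blast
qed

section \<open>Zeros of inward pointing fields on products of balls\<close>

text \<open>A step along \<open>F\<close> followed by projection to the balls has a fixed point.
  There \<open>F x k\<close> is normal to the ball at \<open>x k\<close>; if it were nonzero,
  \<open>x k\<close> would lie on the sphere and \<open>F x k\<close> would point outwards.\<close>

lemma inward_field_zero_on_balls:
  fixes F :: "(nat \<Rightarrow> real ^ 'n) \<Rightarrow> nat \<Rightarrow> real ^ 'n" and R :: real and N :: nat
  assumes "R > 0"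
    and cont: "\<And>k. k < N \<Longrightarrow> continuous_on UNIV (\<lambda>x. F x k)"
    and inward: "\<And>x k. k < N \<Longrightarrow> (\<And>j. norm (x j) \<le> R) \<Longrightarrow> norm (x k) = R \<Longrightarrow> F x k \<bullet> x k \<le> 0"
  shows "\<exists>x. (\<forall>j. norm (x j) \<le> R) \<and> (\<forall>k<N. F x k = 0)"
proof -
  define P :: "real ^ 'n \<Rightarrow> real ^ 'n" where "P = closest_point (cball 0 R)"
  have ball: "closed (cball (0 :: real ^ 'n) R)" "convex (cball (0 :: real ^ 'n) R)" "cball (0 :: real ^ 'n) R \<noteq> {}"
    using \<open>R > 0\<close> by auto
  have P_le: "norm (P y) \<le> R" for y
    using closest_point_in_set[OF ball(1,3), of y] by (simp add: P_def)
  have P_id: "P y = y" if "norm y \<le> R" for y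
    using that by (simp add: P_def closest_point_self)
  have contP: "continuous_on UNIV P"
    unfolding P_def using ball by (intro continuous_on_closest_point)
  define vec :: "(nat \<times> 'n \<Rightarrow> real) \<Rightarrow> nat \<Rightarrow> real ^ 'n" where "vec c k = (\<chi> i. c (k, i))" for c k
  have contvec: "continuous_on S (\<lambda>c. P (vec c k))" for S k
    unfolding vec_def
    by (rule continuous_on_compose2[OF contP])
      (auto intro!: continuous_on_vec_lambda continuous_on_subset[OF continuous_on_product_coordinates])
  \<comment> \<open>The inner projections extend the map from the balls to the whole cube; the outer
    one keeps its values in the ball and hence in the cube.\<close>
  define H where "H c k = P (P (vec c k) + F (\<lambda>j. P (vec c j)) k)" for c k
  have contH: "continuous_on S (\<lambda>c. H c k)" if "k < N" for S k
  proof -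
    have "continuous_on S (\<lambda>c. F (\<lambda>j. P (vec c j)) k)"
      by (rule continuous_on_compose2[OF cont[OF that]])
        (auto intro!: continuous_on_coordinatewise_then_product contvec)
    then show ?thesis unfolding H_def
      by (intro continuous_on_compose2[OF contP]) (auto intro!: continuous_intros contvec)
  qed
  have "\<exists>c\<in>Pi UNIV (\<lambda>p. if p \<in> {..<N} \<times> UNIV then {-R..R} else {0}).
      \<forall>p\<in>{..<N} \<times> UNIV. (\<lambda>p. H c (fst p) $ snd p) p = c p"
  proof (rule brouwer_finite_cube)
    fix c :: "nat \<times> 'n \<Rightarrow> real" and p :: "nat \<times> 'n"
    have "\<bar>H c (fst p) $ snd p\<bar> \<le> R"
      using component_le_norm_cart[of "H c (fst p)" "snd p"] P_le unfolding H_def by (meson order_trans)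
    then show "H c (fst p) $ snd p \<in> {-R..R}" by auto
  qed (use \<open>R > 0\<close> in \<open>auto intro!: continuous_intros contH\<close>)
  then obtain c where c: "c \<in> Pi UNIV (\<lambda>p. if p \<in> {..<N} \<times> UNIV then {-R..R} else {0})"
    and fp: "\<And>k i. k < N \<Longrightarrow> H c k $ i = c (k, i)"
    by fastforce
  define x where "x = vec c"
  have H: "H c k = x k" if "k < N" for k
    using fp[OF that] by (simp add: x_def vec_def vec_eq_iff)
  have x_le: "norm (x k) \<le> R" for k
  proof (cases "k < N")
    case True then show ?thesis using H[OF True] P_le by (metis H_def)
  next
    case False
    then have "c (k, i) = 0" for i using c by (auto simp: Pi_iff dest: spec[of _ k])
    then have "x k = 0" by (simp add: x_def vec_def vec_eq_iff)
    then show ?thesis using \<open>R > 0\<close> by simp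
  qed
  have fix_x: "P (x k + F x k) = x k" if "k < N" for k
    using H[OF that] P_id[OF x_le] by (simp add: H_def flip: x_def)
  have "F x k = 0" if "k < N" for k
  proof (rule ccontr)
    assume nz: "F x k \<noteq> 0"
    \<comment> \<open>Among all points of the ball, \<open>y\<close> is the farthest in direction
      \<open>F x k\<close>, so testing the projection inequality with it is most effective: with
      Cauchy-Schwarz it forces \<open>norm (x k) = R\<close>.\<close>
    define y where "y = (R / norm (F x k)) *\<^sub>R F x k"
    have "norm y = R" using nz \<open>R > 0\<close> by (simp add: y_def)
    then have "(x k + F x k - x k) \<bullet> (y - x k) \<le> 0"
      using closest_point_dot[OF ball(2,1), of y "x k + F x k"] fix_x[OF that] by (simp add: P_def)
    moreover have "F x k \<bullet> y = R * norm (F x k)"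
      using nz by (simp add: y_def power2_norm_eq_inner[symmetric] power2_eq_square)
    ultimately have ge: "R * norm (F x k) \<le> F x k \<bullet> x k"
      by (simp add: inner_diff_right)
    also have "\<dots> \<le> norm (x k) * norm (F x k)"
      using norm_cauchy_schwarz[of "F x k" "x k"] by (simp add: mult.commute)
    finally have "norm (x k) = R" using x_le[of k] nz by simp
    then have "F x k \<bullet> x k \<le> 0" using inward[OF that, of x] x_le by simp
    with ge nz \<open>R > 0\<close> show False
      by (metis mult_pos_pos norm_le_zero_iff not_le order_trans)
  qed
  with x_le show ?thesis by blast
qed

section \<open>The discrete periodic problem and its mesh-independent bound\<close>

lemma phi_of_pos_multiple:
  assumes "\<And>\<xi>. \<xi> \<noteq> 0 \<Longrightarrow> A \<xi> > 0"
  obtains c where "c > 0" "phi_of A \<xi> = c *\<^sub>R \<xi>"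
  using assms by (cases "\<xi> = 0") (auto simp: phi_of_def intro: that[of 1] that[of "A \<xi>"])

text \<open>If \<open>x k\<close> lies on the sphere and its neighbours lie in the ball, the forward
  increment makes a nonpositive and the backward increment a nonnegative inner product with
  \<open>x k\<close>. \<open>phi_of A\<close> preserves these signs, so the discrete field points
  inwards. The function \<open>G\<close> stands for \<open>- f\<close>.\<close>

lemma discrete_periodic_solution:
  fixes G :: "nat \<Rightarrow> real ^ 'n \<Rightarrow> real ^ 'n" and A :: "real ^ 'n \<Rightarrow> real" and h R :: real and N :: nat
  assumes "N > 0" "h > 0" "R > 0"
    and A: "\<And>\<xi>. \<xi> \<noteq> 0 \<Longrightarrow> A \<xi> > 0"
    and cont_phi: "continuous_on UNIV (phi_of A)"
    and cont_G: "\<And>j. j < N \<Longrightarrow> continuous_on UNIV (G j)"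
    and outward: "\<And>j \<xi>. j < N \<Longrightarrow> norm \<xi> = R \<Longrightarrow> G j \<xi> \<bullet> \<xi> \<ge> 0"
  obtains u :: "nat \<Rightarrow> real ^ 'n"
    where "\<And>k. norm (u k) \<le> R" "\<And>k. u (k + N) = u k"
      "\<And>j. phi_of A ((u (Suc (Suc j)) - u (Suc j)) /\<^sub>R h) - phi_of A ((u (Suc j) - u j) /\<^sub>R h)
            = h *\<^sub>R G (j mod N) (u (Suc j))"
proof -
  \<comment> \<open>Adding \<open>N\<close> before subtracting 1 keeps the natural subtraction exact
    at \<open>k = 0\<close>.\<close>
  define next' prev where "next' k = Suc k mod N" and "prev k = (k + N - 1) mod N" for k
  \<comment> \<open>\<open>G\<close> is taken at the preceding index, so the flux change from
    \<open>j\<close> to \<open>Suc j\<close> is driven by \<open>G j\<close>. This shift by one mesh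
    width in time vanishes in the limit.\<close>
  define F where "F x k = phi_of A ((x (next' k) - x k) /\<^sub>R h)
    - phi_of A ((x k - x (prev k)) /\<^sub>R h) - h *\<^sub>R G (prev k) (x k)" for x :: "nat \<Rightarrow> real ^ 'n" and k
  have phi_le: "phi_of A \<xi> \<bullet> y \<le> 0" if "\<xi> \<bullet> y \<le> 0" for \<xi> y
  proof -
    obtain c where "c > 0" "phi_of A \<xi> = c *\<^sub>R \<xi>" using phi_of_pos_multiple A by metis
    then show ?thesis using that by (simp add: mult_le_0_iff)
  qed
  have phi_ge: "phi_of A \<xi> \<bullet> y \<ge> 0" if "\<xi> \<bullet> y \<ge> 0" for \<xi> y
    using phi_le[of \<xi> "- y"] that by simp
  have "\<exists>x. (\<forall>j. norm (x j) \<le> R) \<and> (\<forall>k<N. F x k = 0)"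
  proof (rule inward_field_zero_on_balls[OF \<open>R > 0\<close>])
    fix k assume "k < N"
    have "prev k < N" using \<open>N > 0\<close> by (simp add: prev_def)
    have "continuous_on UNIV (\<lambda>x::nat \<Rightarrow> real ^ 'n. x j)" for j
      by simp
    then show "continuous_on UNIV (\<lambda>x. F x k)" unfolding F_def
      by (intro continuous_intros continuous_on_compose2[OF cont_phi]
          continuous_on_compose2[OF cont_G[OF \<open>prev k < N\<close>]]) auto
    fix x :: "nat \<Rightarrow> real ^ 'n" assume le: "\<And>j. norm (x j) \<le> R" and eq: "norm (x k) = R"
    have *: "x j \<bullet> x k \<le> x k \<bullet> x k" for j
    proof -
      have "x j \<bullet> x k \<le> norm (x j) * norm (x k)" by (rule norm_cauchy_schwarz)
      also have "\<dots> \<le> R * R" using le eq \<open>R > 0\<close> by (intro mult_mono) auto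
      finally show ?thesis using eq by (simp add: power2_norm_eq_inner[symmetric] power2_eq_square)
    qed
    have "phi_of A ((x (next' k) - x k) /\<^sub>R h) \<bullet> x k \<le> 0"
      using * \<open>h > 0\<close> by (intro phi_le) (simp add: inner_diff_left mult_le_0_iff)
    moreover have "phi_of A ((x k - x (prev k)) /\<^sub>R h) \<bullet> x k \<ge> 0"
      using * \<open>h > 0\<close> by (intro phi_ge) (simp add: inner_diff_left)
    moreover have "h *\<^sub>R G (prev k) (x k) \<bullet> x k \<ge> 0"
      using outward[OF \<open>prev k < N\<close> eq] \<open>h > 0\<close> by simp
    ultimately show "F x k \<bullet> x k \<le> 0" by (simp add: F_def inner_diff_left)
  qed
  then obtain x where x: "\<And>j. norm (x j) \<le> R" "\<And>k. k < N \<Longrightarrow> F x k = 0" by blast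
  show thesis
  proof (rule that[of "\<lambda>k. x (k mod N)"])
    fix j
    have "next' (Suc j mod N) = Suc (Suc j) mod N" by (simp add: next'_def mod_Suc_eq)
    moreover have "prev (Suc j mod N) = j mod N"
    proof (cases "Suc j mod N = 0")
      case True
      then have "Suc (j mod N) = N" by (metis mod_Suc nat.simps(3))
      then show ?thesis using True \<open>N > 0\<close> by (simp add: prev_def)
    next
      case False
      then have "Suc j mod N = Suc (j mod N)" by (simp add: mod_Suc split: if_splits)
      then show ?thesis using \<open>N > 0\<close> by (simp add: prev_def)
    qed
    moreover have "F x (Suc j mod N) = 0" using x(2) \<open>N > 0\<close> by simp
    ultimately show "phi_of A ((x (Suc (Suc j) mod N) - x (Suc j mod N)) /\<^sub>R h)
      - phi_of A ((x (Suc j mod N) - x (j mod N)) /\<^sub>R h) = h *\<^sub>R G (j mod N) (x (Suc j mod N))"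
      by (simp add: F_def)
  qed (use x in auto)
qed

text \<open>With \<open>N * h = T\<close> the bound does not depend on the mesh. It uses only that
  \<open>phi_of A\<close> preserves directions, not its growth.\<close>

lemma periodic_flux_bound:
  fixes u :: "nat \<Rightarrow> real ^ 'n" and A :: "real ^ 'n \<Rightarrow> real" and h M :: real and N :: nat
  defines "w \<equiv> \<lambda>k. phi_of A ((u (Suc k) - u k) /\<^sub>R h)"
  assumes "N > 0" "h > 0"
    and A: "\<And>\<xi>. \<xi> \<noteq> 0 \<Longrightarrow> A \<xi> > 0"
    and per: "\<And>k. u (k + N) = u k"
    and step: "\<And>k. norm (w (Suc k) - w k) \<le> h * M"
  shows "norm (w j) \<le> real N * h * M"
proof (rule ccontr)
  assume "\<not> ?thesis"
  then have gt: "norm (w j) > real N * h * M" by simp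
  have "h * M \<ge> 0" using step[of 0] norm_ge_zero order_trans by blast
  have dist: "norm (w (j + i) - w j) \<le> real i * (h * M)" for i
  proof (induction i)
    case (Suc i)
    have "norm (w (j + Suc i) - w j) \<le> norm (w (Suc (j + i)) - w (j + i)) + norm (w (j + i) - w j)"
      using norm_triangle_ineq[of "w (Suc (j + i)) - w (j + i)" "w (j + i) - w j"] by simp
    with Suc step[of "j + i"] show ?case by (simp add: algebra_simps)
  qed simp
  have pos: "(u (Suc (j + i)) - u (j + i)) \<bullet> w j > 0" if "i < N" for i
  proof -
    have "real i * (h * M) \<le> real N * (h * M)"
      using that \<open>h * M \<ge> 0\<close> by (intro mult_right_mono) auto
    then have "norm (w j - w (j + i)) < norm (w j)"
      using dist[of i] gt by (simp add: norm_minus_commute mult.assoc)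
    moreover have "norm (w j) > 0" using calculation norm_ge_zero le_less_trans by blast
    \<comment> \<open>A vector closer to \<open>w j\<close> than the origin is lies in the open half
      space with normal \<open>w j\<close>.\<close>
    ultimately have "(w j - w (j + i)) \<bullet> w j < norm (w j) * norm (w j)"
      by (meson mult_strict_right_mono norm_cauchy_schwarz order_le_less_trans)
    then have "w (j + i) \<bullet> w j > 0"
      by (simp add: inner_diff_left power2_norm_eq_inner[symmetric] power2_eq_square)
    moreover obtain c where "c > 0"
      "phi_of A ((u (Suc (j + i)) - u (j + i)) /\<^sub>R h) = c *\<^sub>R ((u (Suc (j + i)) - u (j + i)) /\<^sub>R h)"
      using phi_of_pos_multiple A by metis
    moreover have "c * inverse h > 0" using \<open>c > 0\<close> \<open>h > 0\<close> by simp
    ultimately show ?thesis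
      using zero_less_mult_pos by (fastforce simp: w_def)
  qed
  have "(\<Sum>i<N. u (Suc (j + i)) - u (j + i)) = 0"
    using sum_lessThan_telescope[of "\<lambda>i. u (j + i)" N] per[of j] by simp
  then have "(\<Sum>i<N. (u (Suc (j + i)) - u (j + i)) \<bullet> w j) = 0"
    by (simp flip: inner_sum_left)
  moreover have "(\<Sum>i<N. (u (Suc (j + i)) - u (j + i)) \<bullet> w j) > 0"
    using pos \<open>N > 0\<close> by (intro sum_pos) auto
  ultimately show False by simp
qed

section \<open>Step functions and piecewise linear interpolation\<close>

text \<open>
  The cells are the intervals \<open>]k h, (k + 1) h]\<close>, closed on the right so that the endpoint \<open>s = N h\<close>
  belongs to cell \<open>N - 1\<close>; truncation in \<^const>\<open>nat\<close> puts \<open>s = 0\<close> into cell \<open>0\<close>.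
\<close>

definition cell :: "real \<Rightarrow> real \<Rightarrow> nat" where
  "cell h s = nat (\<lceil>s / h\<rceil> - 1)"

lemma cell_bounds:
  assumes "h > 0" "s \<ge> 0"
  shows "real (cell h s) * h \<le> s" "s \<le> (real (cell h s) + 1) * h"
proof -
  have "real (cell h s) \<le> s / h \<and> s / h \<le> real (cell h s) + 1"
  proof (cases "s = 0")
    case False
    then have "s / h > 0" using assms by simp
    then have "\<lceil>s / h\<rceil> \<ge> 1" by (simp add: one_le_ceiling)
    then have "real (cell h s) = of_int \<lceil>s / h\<rceil> - 1" by (simp add: cell_def)
    then show ?thesis using ceiling_correct[of "s / h"] by linarith
  qed (simp add: cell_def)
  then show "real (cell h s) * h \<le> s" "s \<le> (real (cell h s) + 1) * h"
    using \<open>h > 0\<close> by (simp_all add: pos_le_divide_eq pos_divide_le_eq)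
qed

lemma cell_eq:
  assumes "h > 0" "real k * h < s" "s \<le> (real k + 1) * h"
  shows "cell h s = k"
proof -
  have "\<lceil>s / h\<rceil> = int k + 1"
    using assms by (intro ceiling_unique) (auto simp: pos_less_divide_eq pos_divide_le_eq)
  then show ?thesis by (simp add: cell_def)
qed

lemma cell_less:
  assumes "h > 0" "N > 0" "s \<le> real N * h"
  shows "cell h s < N"
proof -
  have "s / h \<le> real_of_int (int N)" using assms by (simp add: pos_divide_le_eq)
  then have "\<lceil>s / h\<rceil> \<le> int N" by (rule ceiling_le)
  then show ?thesis using \<open>N > 0\<close> by (simp add: cell_def)
qed

lemma has_integral_step:
  fixes x :: "nat \<Rightarrow> 'a::banach"
  assumes "h > 0"
  shows "((\<lambda>s. x (cell h s)) has_integral (\<Sum>j<k. h *\<^sub>R x j)) {0..real k * h}"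
proof (induction k)
  case (Suc k)
  have "((\<lambda>s. x (cell h s)) has_integral (h *\<^sub>R x k)) {real k * h..real (Suc k) * h}"
  \<comment> \<open>For \<open>k > 0\<close> the left endpoint belongs to the preceding cell; a
    single point does not affect the integral.\<close>
  proof (rule has_integral_spike_finite[of "{real k * h}"])
    show "((\<lambda>_. x k) has_integral (h *\<^sub>R x k)) {real k * h..real (Suc k) * h}"
      using has_integral_const_real[of "x k" "real k * h" "real (Suc k) * h"] \<open>h > 0\<close>
      by (simp add: algebra_simps)
    fix s assume "s \<in> {real k * h..real (Suc k) * h} - {real k * h}"
    then have "cell h s = k" using \<open>h > 0\<close> by (intro cell_eq) (auto simp: algebra_simps)
    then show "x (cell h s) = x k" by simp
  qed auto
  then show ?case
    using has_integral_combine[OF _ _ Suc, of "real (Suc k) * h"] \<open>h > 0\<close> by (simp add: algebra_simps)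
qed (simp add: has_integral_refl)

lemma integrable_step:
  fixes x :: "nat \<Rightarrow> 'a::banach"
  assumes "h > 0" "s \<ge> 0"
  shows "(\<lambda>s. x (cell h s)) integrable_on {s..t}"
proof -
  obtain k where "t / h \<le> real k" using real_arch_simple by blast
  then have "{s..t} \<subseteq> {0..real k * h}" using assms by (auto simp: pos_divide_le_eq)
  then show ?thesis
    using has_integral_step[OF \<open>h > 0\<close>, of x k] integrable_subinterval_real has_integral_integrable by metis
qed

text \<open>The piecewise linear interpolant of the nodes \<open>(k * h, x k)\<close>, written as
  the integral of its slopes: Lipschitz bounds become bounds on an integrand, and limits follow by
  dominated convergence.\<close>

definition interp :: "real \<Rightarrow> (nat \<Rightarrow> 'a::real_normed_vector) \<Rightarrow> real \<Rightarrow> 'a" where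
  "interp h x t = x 0 + integral {0..t} (\<lambda>s. (x (Suc (cell h s)) - x (cell h s)) /\<^sub>R h)"

lemma interp_node:
  fixes x :: "nat \<Rightarrow> 'a::banach"
  assumes "h > 0"
  shows "interp h x (real k * h) = x k"
  using integral_unique[OF has_integral_step[OF assms, of "\<lambda>j. (x (Suc j) - x j) /\<^sub>R h" k]] assms
  by (simp add: interp_def sum_lessThan_telescope)

lemma interp_lipschitz:
  fixes x :: "nat \<Rightarrow> 'a::banach"
  assumes "h > 0" and step: "\<And>k. norm (x (Suc k) - x k) \<le> h * L" and "0 \<le> s" "s \<le> t"
  shows "norm (interp h x t - interp h x s) \<le> L * (t - s)"
proof -
  let ?d = "\<lambda>s. (x (Suc (cell h s)) - x (cell h s)) /\<^sub>R h"
  note int = integrable_step[OF \<open>h > 0\<close>, of _ "\<lambda>j. (x (Suc j) - x j) /\<^sub>R h"]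
  have split: "integral {0..s} ?d + integral {s..t} ?d = integral {0..t} ?d"
    using Henstock_Kurzweil_Integration.integral_combine[OF \<open>0 \<le> s\<close> \<open>s \<le> t\<close> int[of 0 t]] by simp
  have "norm (interp h x t - interp h x s) = norm (integral {s..t} ?d)"
    by (simp only: interp_def flip: split) simp
  also have "\<dots> \<le> integral {s..t} (\<lambda>_. L)"
    using int[of s t] step assms
    by (intro integral_norm_bound_integral) (auto simp: divide_simps mult.commute)
  also have "\<dots> = L * (t - s)" using assms by simp
  finally show ?thesis .
qed

lemma interp_cell:
  fixes x :: "nat \<Rightarrow> 'a::banach"
  assumes "h > 0" and step: "\<And>k. norm (x (Suc k) - x k) \<le> h * L" and "0 \<le> t"
  shows "norm (interp h x t - x (cell h t)) \<le> L * h"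
proof -
  have "0 \<le> h * L" using step[of 0] norm_ge_zero order_trans by blast
  then have "L \<ge> 0" using \<open>h > 0\<close> by (simp add: zero_le_mult_iff)
  note b = cell_bounds[OF \<open>h > 0\<close> \<open>0 \<le> t\<close>]
  have "norm (interp h x t - interp h x (real (cell h t) * h)) \<le> L * (t - real (cell h t) * h)"
    using b \<open>h > 0\<close> step by (intro interp_lipschitz) auto
  also have "\<dots> \<le> L * h"
    using b \<open>L \<ge> 0\<close> by (intro mult_left_mono) (auto simp: algebra_simps)
  finally show ?thesis using interp_node[OF \<open>h > 0\<close>] by metis
qed

lemma cell_tendsto:
  assumes "\<And>m. h m > 0" "h \<longlonglongrightarrow> 0" "s \<ge> 0"
  shows "(\<lambda>m. real (cell (h m) s) * h m) \<longlonglongrightarrow> s"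
proof -
  have "(\<lambda>m. real (cell (h m) s) * h m - s) \<longlonglongrightarrow> 0"
  proof (rule Lim_null_comparison[OF always_eventually \<open>h \<longlonglongrightarrow> 0\<close>], rule allI)
    show "norm (real (cell (h m) s) * h m - s) \<le> h m" for m
      using cell_bounds[OF assms(1)[of m] \<open>s \<ge> 0\<close>] by (simp add: algebra_simps)
  qed
  then show ?thesis by (simp add: LIM_zero_iff)
qed

text \<open>Interpolant and adjacent nodal values differ by multiples of \<open>L * h m\<close>,
  which tend to zero. This transfers limits of the interpolants to the nodal values in the discrete
  equations.\<close>

lemma interp_limit_nodes:
  fixes x :: "nat \<Rightarrow> nat \<Rightarrow> 'a::banach"
  assumes h: "\<And>m. h m > 0" "h \<longlonglongrightarrow> 0"
    and step: "\<And>m k. norm (x m (Suc k) - x m k) \<le> h m * L"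
    and lim: "(\<lambda>m. interp (h m) (x m) t) \<longlonglongrightarrow> y" and "t \<ge> 0"
  shows "(\<lambda>m. x m (cell (h m) t)) \<longlonglongrightarrow> y" "(\<lambda>m. x m (Suc (cell (h m) t))) \<longlonglongrightarrow> y"
proof -
  have hL: "(\<lambda>m. L * h m) \<longlonglongrightarrow> 0" using tendsto_mult_right_zero[OF h(2)] .
  have "\<forall>m. norm (interp (h m) (x m) t - x m (cell (h m) t)) \<le> L * h m"
    using interp_cell h(1) step \<open>t \<ge> 0\<close> by blast
  then have "(\<lambda>m. interp (h m) (x m) t - x m (cell (h m) t)) \<longlonglongrightarrow> 0"
    by (intro Lim_null_comparison[OF always_eventually hL])
  from tendsto_diff[OF lim this] show *: "(\<lambda>m. x m (cell (h m) t)) \<longlonglongrightarrow> y" by simp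
  have "(\<lambda>m. x m (Suc (cell (h m) t)) - x m (cell (h m) t)) \<longlonglongrightarrow> 0"
    by (rule Lim_null_comparison[OF always_eventually hL])
      (use step in \<open>auto simp: mult.commute\<close>)
  from tendsto_add[OF this *] show "(\<lambda>m. x m (Suc (cell (h m) t))) \<longlonglongrightarrow> y" by simp
qed

text \<open>The slopes are dominated by the constant \<open>L\<close>, so their pointwise
  convergence suffices to pass to the limit in the integral defining the interpolant.\<close>

lemma interp_limit_integral:
  fixes x :: "nat \<Rightarrow> nat \<Rightarrow> 'a::euclidean_space"
  assumes h: "\<And>m. h m > 0"
    and step: "\<And>m k. norm (x m (Suc k) - x m k) \<le> h m * L"
    and lim: "\<And>s. s \<in> {0..t} \<Longrightarrow> (\<lambda>m. interp (h m) (x m) s) \<longlonglongrightarrow> X s"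
    and slope: "\<And>s. s \<in> {0..t} \<Longrightarrow>
      (\<lambda>m. (x m (Suc (cell (h m) s)) - x m (cell (h m) s)) /\<^sub>R h m) \<longlonglongrightarrow> q s"
    and "t \<ge> 0"
  shows "X t = X 0 + integral {0..t} q"
proof -
  have "(\<lambda>m. integral {0..t} (\<lambda>s. (x m (Suc (cell (h m) s)) - x m (cell (h m) s)) /\<^sub>R h m))
      \<longlonglongrightarrow> integral {0..t} q"
  proof (rule dominated_convergence(2)[where h = "\<lambda>_. L"])
    show "(\<lambda>s. (x m (Suc (cell (h m) s)) - x m (cell (h m) s)) /\<^sub>R h m) integrable_on {0..t}" for m
      using integrable_step[OF h, of 0 "\<lambda>j. (x m (Suc j) - x m j) /\<^sub>R h m"] by simp
    show "norm ((x m (Suc (cell (h m) s)) - x m (cell (h m) s)) /\<^sub>R h m) \<le> L" for m s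
      using step[of m "cell (h m) s"] h[of m] by (simp add: divide_simps mult.commute)
  qed (use slope in auto)
  moreover have "(\<lambda>m. x m 0) \<longlonglongrightarrow> X 0"
    using lim[of 0] \<open>t \<ge> 0\<close> by (simp add: interp_def)
  ultimately have "(\<lambda>m. interp (h m) (x m) t) \<longlonglongrightarrow> X 0 + integral {0..t} q"
    unfolding interp_def by (intro tendsto_add)
  with lim[of t] \<open>t \<ge> 0\<close> show ?thesis using LIMSEQ_unique by auto
qed

lemma lipschitz_abs_continuous_on:
  fixes g :: "real \<Rightarrow> 'a::real_normed_vector"
  assumes "\<And>a b. a \<in> I \<Longrightarrow> b \<in> I \<Longrightarrow> a \<le> b \<Longrightarrow> norm (g b - g a) \<le> L * (b - a)" "L \<ge> 0"
  shows "abs_continuous_on I g"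
  unfolding abs_continuous_on_def
proof (intro allI impI)
  fix \<epsilon> :: real assume "\<epsilon> > 0"
  show "\<exists>\<delta>>0. \<forall>(n::nat) (a::nat \<Rightarrow> real) (b::nat \<Rightarrow> real).
        (\<forall>i<n. a i < b i \<and> {a i..b i} \<subseteq> I) \<and>
        disjoint_family_on (\<lambda>i. {a i<..<b i}) {..<n} \<and>
        (\<Sum>i<n. b i - a i) < \<delta>
        \<longrightarrow> (\<Sum>i<n. norm (g (b i) - g (a i))) < \<epsilon>"
  \<comment> \<open>Dividing by \<open>L + 1\<close> rather than \<open>L\<close> covers the case
    \<open>L = 0\<close>.\<close>
  proof (intro exI[of _ "\<epsilon> / (L + 1)"] conjI allI impI)
    show "\<epsilon> / (L + 1) > 0" using \<open>\<epsilon> > 0\<close> \<open>L \<ge> 0\<close> by simp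
    fix n :: nat and a b :: "nat \<Rightarrow> real"
    assume *: "(\<forall>i<n. a i < b i \<and> {a i..b i} \<subseteq> I) \<and>
        disjoint_family_on (\<lambda>i. {a i<..<b i}) {..<n} \<and> (\<Sum>i<n. b i - a i) < \<epsilon> / (L + 1)"
    have "(\<Sum>i<n. norm (g (b i) - g (a i))) \<le> (\<Sum>i<n. (L + 1) * (b i - a i))"
    proof (rule sum_mono)
      fix i assume "i \<in> {..<n}"
      then have "a i < b i" "{a i..b i} \<subseteq> I" using * by auto
      then have "norm (g (b i) - g (a i)) \<le> L * (b i - a i)" by (intro assms) auto
      also have "\<dots> \<le> (L + 1) * (b i - a i)" using \<open>a i < b i\<close> by (intro mult_right_mono) auto
      finally show "norm (g (b i) - g (a i)) \<le> (L + 1) * (b i - a i)" .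
    qed
    also have "\<dots> = (L + 1) * (\<Sum>i<n. b i - a i)" by (simp add: sum_distrib_left)
    also have "\<dots> < (L + 1) * (\<epsilon> / (L + 1))" using * \<open>L \<ge> 0\<close> by (intro mult_strict_left_mono) auto
    finally show "(\<Sum>i<n. norm (g (b i) - g (a i))) < \<epsilon>" using \<open>L \<ge> 0\<close> by simp
  qed
qed

theorem theorem5p1:
  fixes T R :: real
    and f :: "real \<Rightarrow> real ^ 'n \<Rightarrow> real ^ 'n"
    and A :: "real ^ 'n \<Rightarrow> real"
  assumes "T > 0"
    and "continuous_on ({0..T} \<times> UNIV) (\<lambda>(t, \<xi>). f t \<xi>)"
    and "continuous_on (UNIV - {0}) A"
    and "\<And>\<xi>. \<xi> \<noteq> 0 \<Longrightarrow> A \<xi> > 0"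
    and "\<exists>\<psi>. homeomorphism UNIV UNIV (phi_of A) \<psi>"
    and "R > 0"
    and "\<And>t \<xi>. t \<in> {0..T} \<Longrightarrow> norm \<xi> = R \<Longrightarrow> f t \<xi> \<bullet> \<xi> \<le> 0"
  shows "\<exists>u. periodic_solution T (phi_of A) f u \<and> (\<forall>t\<in>{0..T}. norm (u t) \<le> R)"
proof -

  \<comment> \<open>Constants independent of the mesh\<close>
  obtain \<psi> where homeo: "homeomorphism UNIV UNIV (phi_of A) \<psi>" using assms(5) by blast
  then have cont_phi: "continuous_on UNIV (phi_of A)" and cont_psi: "continuous_on UNIV \<psi>"
    and psi_phi: "\<And>\<xi>. \<psi> (phi_of A \<xi>) = \<xi>" and phi_psi: "\<And>w. phi_of A (\<psi> w) = w"
    by (auto simp: homeomorphism_def)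
  have cont_f: "continuous_on {0..T} (\<lambda>t. f t (u t))" if "continuous_on {0..T} u" for u
    using continuous_on_compose2[OF assms(2), of "{0..T}" "\<lambda>t. (t, u t)"] that
    by (simp add: continuous_on_Pair image_subset_iff)
  have cont_f_snd: "continuous_on UNIV (f t)" if "t \<in> {0..T}" for t
    using continuous_on_compose2[OF assms(2), of UNIV "\<lambda>\<xi>. (t, \<xi>)"] that
    by (simp add: continuous_on_Pair image_subset_iff)
  have "compact ((\<lambda>(t, \<xi>). f t \<xi>) ` ({0..T} \<times> cball 0 R))"
    by (intro compact_continuous_image continuous_on_subset[OF assms(2)] compact_Times) auto
  then obtain M where "M > 0" and M': "\<forall>y\<in>(\<lambda>(t, \<xi>). f t \<xi>) ` ({0..T} \<times> cball 0 R). norm y \<le> M"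
    using compact_imp_bounded bounded_pos by metis
  have M: "norm (f t \<xi>) \<le> M" if "t \<in> {0..T}" "norm \<xi> \<le> R" for t \<xi>
  proof -
    have "(t, \<xi>) \<in> {0..T} \<times> cball 0 R" using that by simp
    then show ?thesis using M' by blast
  qed
  \<comment> \<open>The discrete fluxes will lie in the ball of radius \<open>T * M\<close>;
    \<open>V\<close> then bounds the difference quotients, which are their images under
    \<open>\<psi>\<close>.\<close>
  have "compact (\<psi> ` cball 0 (T * M))"
    by (intro compact_continuous_image continuous_on_subset[OF cont_psi]) auto
  then obtain V where V': "\<forall>y\<in>\<psi> ` cball 0 (T * M). norm y \<le> V"
    using compact_imp_bounded bounded_pos by metis
  have V: "norm (\<psi> y) \<le> V" if "norm y \<le> T * M" for y
    using V' that by auto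
  define L where "L = max M V"
  have "L > 0" using \<open>M > 0\<close> by (simp add: L_def)

  \<comment> \<open>Discrete solutions and their uniform estimates\<close>
  define h where "h m = T / real (Suc m)" for m
  have h: "h m > 0" for m using \<open>T > 0\<close> by (simp add: h_def)
  have hN: "real (Suc m) * h m = T" for m by (simp add: h_def)
  have h0: "h \<longlonglongrightarrow> 0"
    using tendsto_mult_right_zero[OF LIMSEQ_inverse_real_of_nat, of T] unfolding h_def
    by (simp add: divide_inverse)
  have node: "real j * h m \<in> {0..T}" if "j < Suc m" for j m
    using that mult_right_mono[of "real j" "real (Suc m)" "h m"] hN[of m] h[of m]
    by (simp del: of_nat_Suc)
  define w where "w u m j = phi_of A ((u (Suc j) - u j) /\<^sub>R h m)" for u m j
  have "\<exists>u. (\<forall>k. norm (u k) \<le> R) \<and> (\<forall>k. u (k + Suc m) = u k) \<and>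
    (\<forall>j. w u m (Suc j) - w u m j = h m *\<^sub>R - f (real (j mod Suc m) * h m) (u (Suc j)))" for m
    unfolding w_def
    by (rule discrete_periodic_solution[of "Suc m" "h m" R A "\<lambda>j \<xi>. - f (real j * h m) \<xi>"])
      (use h assms(4,6,7) cont_phi node in \<open>auto intro!: continuous_intros cont_f_snd\<close>)
  then obtain u where u_le: "\<And>m k. norm (u m k) \<le> R" and u_per: "\<And>m k. u m (k + Suc m) = u m k"
    and u_eq: "\<And>m j. w (u m) m (Suc j) - w (u m) m j
      = h m *\<^sub>R - f (real (j mod Suc m) * h m) (u m (Suc j))"
    by metis
  define v where "v m = w (u m) m" for m
  have v_step_M: "norm (v m (Suc j) - v m j) \<le> h m * M" for m j
    using M[OF node[of "j mod Suc m" m] u_le[of m "Suc j"]] u_eq[of m j] h[of m] by (simp add: v_def)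
  then have v_step: "norm (v m (Suc j) - v m j) \<le> h m * L" for m j
    using h[of m] by (smt (verit) L_def max.cobounded1 mult_left_mono)
  have v_le: "norm (v m j) \<le> T * M" for m j
    using periodic_flux_bound[of "Suc m" "h m" A "u m" M j] h[of m] assms(4) u_per[of m] v_step_M[of m] hN[of m]
    by (simp add: v_def w_def)
  have slope: "(u m (Suc j) - u m j) /\<^sub>R h m = \<psi> (v m j)" for m j
    by (simp add: v_def w_def psi_phi)
  have u_step: "norm (u m (Suc j) - u m j) \<le> h m * L" for m j
  proof -
    have "u m (Suc j) - u m j = h m *\<^sub>R \<psi> (v m j)"
      using h[of m] by (simp flip: slope)
    moreover have "norm (\<psi> (v m j)) \<le> L" using V[OF v_le] by (simp add: L_def max.coboundedI2)
    ultimately show ?thesis using h[of m] by simp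
  qed
  have v_per: "v m (k + Suc m) = v m k" for m k
    using u_per[of m k] u_per[of m "Suc k"] by (simp add: v_def w_def)

  \<comment> \<open>Compactness\<close>
  \<comment> \<open>Pairing the two interpolants yields one subsequence along which both
    converge.\<close>
  define Z where "Z m t = (interp (h m) (u m) t, interp (h m) (v m) t)" for m t
  have Z_lip: "norm (Z m t - Z m s) \<le> 2 * L * \<bar>t - s\<bar>" if "s \<ge> 0" "t \<ge> 0" for m s t
  proof -
    have "norm (Z m t - Z m s) \<le> 2 * L * (t - s)" if "0 \<le> s" "s \<le> t" for s t
      using norm_Pair_le[of "interp (h m) (u m) t - interp (h m) (u m) s"
          "interp (h m) (v m) t - interp (h m) (v m) s"]
        interp_lipschitz[where x = "u m", OF h u_step that]
        interp_lipschitz[where x = "v m", OF h v_step that]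
      by (simp add: Z_def algebra_simps)
    from this[of s t] this[of t s] that show ?thesis
      by (cases "s \<le> t") (auto simp: norm_minus_commute)
  qed
  have Z_bound: "norm (Z m t) \<le> R + T * M + 2 * L * T" if "t \<in> {0..T}" for m t
  proof -
    have "norm (Z m 0) \<le> R + T * M"
      using norm_Pair_le[of "u m 0" "v m 0"] u_le[of m 0] v_le[of m 0] by (simp add: Z_def interp_def)
    moreover have "norm (Z m t - Z m 0) \<le> 2 * L * T"
      using Z_lip[of 0 t m] that \<open>L > 0\<close> by (auto intro: order_trans mult_left_mono)
    ultimately show ?thesis using norm_triangle_sub[of "Z m t" "Z m 0"] by simp
  qed
  obtain g k where k: "strict_mono (k :: nat \<Rightarrow> nat)"
    and "\<And>e. 0 < e \<Longrightarrow> \<exists>N. \<forall>n x. n \<ge> N \<and> x \<in> {0..T} \<longrightarrow> norm (Z (k n) x - g x) < e"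
  proof (rule Arzela_Ascoli[of "{0..T}" Z, OF _ Z_bound])
    fix x e :: real assume "x \<in> {0..T}" "e > 0"
    show "\<exists>d>0. \<forall>n y. y \<in> {0..T} \<and> norm (x - y) < d \<longrightarrow> norm (Z n x - Z n y) < e"
    proof (intro exI[of _ "e / (2 * L)"] conjI allI impI)
      fix n y assume y: "y \<in> {0..T} \<and> norm (x - y) < e / (2 * L)"
      then have "norm (Z n x - Z n y) \<le> 2 * L * \<bar>x - y\<bar>"
        using Z_lip \<open>x \<in> {0..T}\<close> by auto
      also have "\<dots> < e" using y \<open>L > 0\<close> by (simp add: pos_less_divide_eq mult.commute)
      finally show "norm (Z n x - Z n y) < e" .
    qed (use \<open>e > 0\<close> \<open>L > 0\<close> in auto)
  qed auto
  then have Z_lim: "(\<lambda>n. Z (k n) t) \<longlonglongrightarrow> g t" if "t \<in> {0..T}" for t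
    using that unfolding LIMSEQ_iff by blast
  define U W where "U t = fst (g t)" and "W t = snd (g t)" for t
  have U_lim: "(\<lambda>n. interp (h (k n)) (u (k n)) t) \<longlonglongrightarrow> U t"
    and W_lim: "(\<lambda>n. interp (h (k n)) (v (k n)) t) \<longlonglongrightarrow> W t" if "t \<in> {0..T}" for t
    using tendsto_fst[OF Z_lim[OF that]] tendsto_snd[OF Z_lim[OF that]] by (simp_all add: Z_def U_def W_def)
  have hk: "h (k n) > 0" for n by (rule h)
  have hk0: "(\<lambda>n. h (k n)) \<longlonglongrightarrow> 0" using LIMSEQ_subseq_LIMSEQ[OF h0 k] by (simp add: o_def)
  have U_nodes: "(\<lambda>n. u (k n) (cell (h (k n)) t)) \<longlonglongrightarrow> U t"
      "(\<lambda>n. u (k n) (Suc (cell (h (k n)) t))) \<longlonglongrightarrow> U t"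
    and W_nodes: "(\<lambda>n. v (k n) (cell (h (k n)) t)) \<longlonglongrightarrow> W t" if "t \<in> {0..T}" for t
    using interp_limit_nodes[where x = "\<lambda>n. u (k n)", OF hk hk0 u_step U_lim[OF that]] interp_limit_nodes[where x = "\<lambda>n. v (k n)", OF hk hk0 v_step W_lim[OF that]]
      that by auto

  \<comment> \<open>Regularity of the limits and their integral equations\<close>
  have W_lip: "norm (W t - W s) \<le> L * (t - s)" if "s \<in> {0..T}" "t \<in> {0..T}" "s \<le> t" for s t
  proof (rule Lim_bounded)
    show "(\<lambda>n. norm (interp (h (k n)) (v (k n)) t - interp (h (k n)) (v (k n)) s)) \<longlonglongrightarrow> norm (W t - W s)"
      using that by (intro tendsto_intros W_lim)
  qed (use interp_lipschitz[where x = "v (k n)" for n, OF h v_step] that in auto)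
  have cont_W: "continuous_on {0..T} W"
    using W_lip \<open>L > 0\<close>
    by (intro lipschitz_on_continuous_on[of L] lipschitz_on_leI) (auto simp: dist_norm norm_minus_commute)
  have cont_psiW: "continuous_on {0..T} (\<lambda>t. \<psi> (W t))"
    using continuous_on_compose2[OF cont_psi cont_W] by simp
  have U_int: "U t = U 0 + integral {0..t} (\<lambda>s. \<psi> (W s))" if "t \<in> {0..T}" for t
  proof (rule interp_limit_integral[where x = "\<lambda>n. u (k n)", OF hk u_step U_lim])
    fix s assume "s \<in> {0..t}"
    then have "s \<in> {0..T}" using that by auto
    have "(\<lambda>n. \<psi> (v (k n) (cell (h (k n)) s))) \<longlonglongrightarrow> \<psi> (W s)"
      by (rule continuous_on_tendsto_compose[OF cont_psi W_nodes[OF \<open>s \<in> {0..T}\<close>]]) auto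
    then show "(\<lambda>n. (u (k n) (Suc (cell (h (k n)) s)) - u (k n) (cell (h (k n)) s)) /\<^sub>R h (k n)) \<longlonglongrightarrow> \<psi> (W s)"
      by (simp only: slope)
  qed (use that in auto)
  have W_int: "W t = W 0 + integral {0..t} (\<lambda>s. - f s (U s))" if "t \<in> {0..T}" for t
  proof (rule interp_limit_integral[where x = "\<lambda>n. v (k n)", OF hk v_step W_lim])
    fix s assume "s \<in> {0..t}"
    then have s: "s \<in> {0..T}" using that by auto
    define j where "j n = cell (h (k n)) s" for n
    \<comment> \<open>This makes the \<open>mod\<close> in \<open>u_eq\<close> trivial. At
      \<open>s = T\<close> it relies on the cells being closed on the right.\<close>
    have j: "j n < Suc (k n)" for n
      using s hN[of "k n"] unfolding j_def by (intro cell_less hk) auto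
    have quot: "(v (k n) (Suc (j n)) - v (k n) (j n)) /\<^sub>R h (k n) = - f (real (j n) * h (k n)) (u (k n) (Suc (j n)))" for n
      using u_eq[of "k n" "j n"] hk[of n] j[of n] by (simp add: v_def)
    \<comment> \<open>Time is sampled at the left end of the cell and the state at its right end;
      both converge.\<close>
    have "(\<lambda>n. (real (j n) * h (k n), u (k n) (Suc (j n)))) \<longlonglongrightarrow> (s, U s)"
      unfolding j_def using s by (intro tendsto_intros cell_tendsto hk hk0 U_nodes) auto
    then have "(\<lambda>n. f (real (j n) * h (k n)) (u (k n) (Suc (j n)))) \<longlonglongrightarrow> f s (U s)"
      using continuous_on_tendsto_compose[OF assms(2)] s node[OF j] by fastforce
    then have "(\<lambda>n. - f (real (j n) * h (k n)) (u (k n) (Suc (j n)))) \<longlonglongrightarrow> - f s (U s)"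
      by (rule tendsto_minus)
    then show "(\<lambda>n. (v (k n) (Suc (cell (h (k n)) s)) - v (k n) (cell (h (k n)) s)) /\<^sub>R h (k n)) \<longlonglongrightarrow> - f s (U s)"
      by (simp only: quot flip: j_def)
  qed (use that in auto)
  have has_deriv: "(Y has_vector_derivative q t) (at t within {0..T})"
    if "\<And>t. t \<in> {0..T} \<Longrightarrow> Y t = Y 0 + integral {0..t} q" "continuous_on {0..T} q" "t \<in> {0..T}"
    for Y q :: "real \<Rightarrow> real ^ 'n" and t
  proof -
    have "((\<lambda>t. Y 0 + integral {0..t} q) has_vector_derivative 0 + q t) (at t within {0..T})"
      using that(2,3)
      by (intro has_vector_derivative_add has_vector_derivative_const integral_has_vector_derivative)
    then have "((\<lambda>t. Y 0 + integral {0..t} q) has_vector_derivative q t) (at t within {0..T})"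
      by simp
    then show ?thesis
      by (rule has_vector_derivative_transform[OF that(3) that(1), rotated])
  qed
  note U_deriv = has_deriv[of U "\<lambda>t. \<psi> (W t)", OF U_int cont_psiW]
  have "continuous_on {0..T} U"
    using U_deriv by (meson continuous_on_eq_continuous_within has_vector_derivative_continuous)
  from has_deriv[of W "\<lambda>t. - f t (U t)", OF W_int continuous_on_minus[OF cont_f[OF this]]]
  have W_deriv: "(W has_vector_derivative - f t (U t)) (at t within {0..T})" if "t \<in> {0..T}" for t
    using that by simp

  \<comment> \<open>Periodicity, the equation and the bound for the limit\<close>
  have end_eq: "interp (h m) (u m) 0 = interp (h m) (u m) T" "interp (h m) (v m) 0 = interp (h m) (v m) T" for m
    using interp_node[OF h[of m], of "u m" "Suc m"] interp_node[OF h[of m], of "v m" "Suc m"] hN[of m]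
      u_per[of m 0] v_per[of m 0] by (simp_all add: interp_def)
  have "U 0 = U T" "W 0 = W T"
    using U_lim[of 0] U_lim[of T] W_lim[of 0] W_lim[of T] \<open>T > 0\<close> LIMSEQ_unique
    by (fastforce simp: end_eq)+
  moreover have "abs_continuous_on {0..T} W"
    using W_lip \<open>L > 0\<close> by (intro lipschitz_abs_continuous_on) auto
  \<comment> \<open>The derivative is \<open>\<psi> (W t)\<close>, so the flux is \<open>W\<close>
    by \<open>phi_psi\<close>, and \<open>W 0 = W T\<close> gives the periodicity of the derivative.
    The equation holds at every point, with \<open>d = - f t (U t)\<close>.\<close>
  ultimately have "periodic_solution T (phi_of A) f U"
    unfolding periodic_solution_def using U_deriv W_deriv cont_psiW
    by (intro exI[of _ "\<lambda>t. \<psi> (W t)"])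
      (auto simp: phi_psi space_restrict_space intro!: AE_I2 exI[of _ "- f _ (U _)"])
  moreover have "norm (U t) \<le> R" if "t \<in> {0..T}" for t
    using Lim_bounded[OF tendsto_norm[OF U_nodes(1)[OF that]], of 0] u_le by blast
  ultimately show ?thesis by blast
qed

end
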